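(* Let $m\ge 0$ be an integer and let $\omega_1,\dots,\omega_{2m+2}\in S\oplus V$ be linearly independent over $\mathbb{R}$. Let $\zeta=\zeta_{2m+2}$ be the Weierstrass-type zeta function of the lattice $2\mathbb{Z}\omega_1+\cdots+2\mathbb{Z}\omega_{2m+2}$. For $i\in\{1,\dots,2m+2\}$ define $$S_i(x)=\Big[(I+E_i)\prod_{\substack{1\le j\le 2m+2\\ j\neq i}}(I-E_j)\Big](\zeta)(x).$$ Then $S_i$ is periodic with periods $2\omega_1,\dots,2\omega_{i-1},\omega_i,2\omega_{i+1},\dots,2\omega_{2m+2}$; that is, for every $x\in (S\oplus V)\setminus(\mathbb{Z}\omega_1+\cdots+\mathbb{Z}\omega_{2m+2})$, $$S_i(x+\omega_i)=S_i(x)\quad\text{and}\quad S_i(x+2\omega_k)=S_i(x)\ \text{ for all } k\neq i.$$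
   Context: $\mathbb{R}_{0,2m+1}$ is the real Clifford algebra of the vector space $V=\mathbb{R}^{2m+1}$ with negative definite quadratic form: it is generated by an orthonormal basis $e_1,\dots,e_{2m+1}$ of $V$ with $e_ie_j+e_je_i=-2\delta_{ij}$ for $1\le i,j\le 2m+1$; $S\cong\mathbb{R}$ denotes the scalars. Elements $x=x_0+\sum_{i=1}^{2m+1}x_ie_i$ of $S\oplus V\cong\mathbb{R}^{2m+2}$ are called paravectors; every nonzero paravector is invertible in $\mathbb{R}_{0,2m+1}$, with inverse a paravector. Zeta function: for $N\in\{1,\dots,2m+2\}$ and $\mathbb{R}$-linearly independent paravectors $\omega_1,\dots,\omega_N$ (half periods), enumerate the lattice $2\mathbb{Z}\omega_1+\cdots+2\mathbb{Z}\omega_N$ as $\{w_p\}_{p\ge 0}$ with $w_0=0$, and for $x\in S\oplus V$ not in this lattice set $$\zeta_N(x)=x^{-1}+\sum_{p=1}^\infty\Big\{(x-w_p)^{-1}+\sum_{\mu=0}^{N-1}(w_p^{-1}x)^\mu w_p^{-1}\Big\}\in\mathbb{R}_{0,2m+1}.$$ Translation operators: for a function $\varphi$ on $S\oplus V$ (possibly with isolated singularities) with values in $\mathbb{R}_{0,2m+1}$, $I$ is the identity operator and $E_j(\varphi)(x)=\varphi(x+\omega_j)$. These operators commute; products denote composition. *)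

theory Defs
  imports "HOL-Analysis.Analysis"
begin

section \<open>The Clifford algebra with negative definite form\<close>

text \<open>
  An element is given by its real coefficients with respect to the basis blades
  \<open>e\<^sub>A = e\<^sub>i\<^sub>1 \<cdots> e\<^sub>i\<^sub>r\<close>, where \<open>A = {i\<^sub>1 < \<dots> < i\<^sub>r}\<close>
  ranges over the subsets of the linearly ordered index type \<open>'n\<close>.
  For \<open>CARD('n) = n\<close> this is the algebra of dimension \<open>2^n\<close>
  generated by \<open>n\<close> anticommuting square roots of \<open>-1\<close>.
\<close>

typedef (overloaded) 'n clifford = "UNIV :: ('n::{finite,linorder} set \<Rightarrow> real) set"
  morphisms coef Clifford
  by simp

setup_lifting type_definition_clifford

lemma clifford_eqI: "(\<And>A. coef x A = coef y A) \<Longrightarrow> x = y"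
  by (simp add: coef_inject[symmetric] fun_eq_iff)

text \<open>
  Reordering the word \<open>e\<^sub>A e\<^sub>B\<close> costs a factor \<open>-1\<close> for each pair
  \<open>i \<in> A\<close>, \<open>j \<in> B\<close> with \<open>j < i\<close>; pairs with \<open>j = i\<close> contribute
  \<open>e\<^sub>i\<^sup>2 = -1\<close>. Hence \<open>e\<^sub>A e\<^sub>B\<close> is \<open>blade_sign A B\<close> times
  the blade of the symmetric difference of \<open>A\<close> and \<open>B\<close>.
\<close>

definition blade_sign :: "'n::linorder set \<Rightarrow> 'n set \<Rightarrow> real" where
  "blade_sign A B = (\<Prod>i\<in>A. \<Prod>j\<in>B. if j \<le> i then -1 else 1)"

lemma prod_sym_diff:
  fixes f :: "'a::finite \<Rightarrow> real"
  assumes "\<And>i. f i * f i = 1"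
  shows "prod f (sym_diff A B) = prod f A * prod f B"
proof -
  have A: "prod f A = prod f (A - B) * prod f (A \<inter> B)"
    by (subst prod.union_disjoint[symmetric]) (auto intro: prod.cong)
  have B: "prod f B = prod f (B - A) * prod f (A \<inter> B)"
    by (subst prod.union_disjoint[symmetric]) (auto intro: prod.cong)
  have "prod f (A \<inter> B) * prod f (A \<inter> B) = 1"
    by (simp add: prod.distrib[symmetric] assms)
  then have "prod f A * prod f B = prod f (A - B) * prod f (B - A)"
    unfolding A B by (simp add: mult.assoc mult.left_commute)
  also have "\<dots> = prod f (sym_diff A B)"
    by (subst prod.union_disjoint) auto
  finally show ?thesis by simp
qed

lemma blade_sign_sym_diff_left:
  fixes A B C :: "'n::{finite,linorder} set"
  shows "blade_sign (sym_diff A B) C = blade_sign A C * blade_sign B C"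
  unfolding blade_sign_def
  by (rule prod_sym_diff) (simp add: prod.distrib[symmetric] if_distrib cong: if_cong)

lemma blade_sign_sym_diff_right:
  fixes A B C :: "'n::{finite,linorder} set"
  shows "blade_sign A (sym_diff B C) = blade_sign A B * blade_sign A C"
  unfolding blade_sign_def
  by (subst prod_sym_diff) (simp_all add: prod.distrib)

lemma blade_sign_empty [simp]: "blade_sign {} B = 1" "blade_sign A {} = 1"
  by (simp_all add: blade_sign_def)

lemma sum_sym_diff_reindex:
  fixes g :: "'n::finite set \<Rightarrow> real"
  shows "(\<Sum>C\<in>UNIV. g (sym_diff A C)) = (\<Sum>C\<in>UNIV. g C)"
  by (rule sum.reindex_bij_witness[of _ "sym_diff A" "sym_diff A"])
     (auto intro!: arg_cong[of _ _ g])

instantiation clifford :: ("{finite,linorder}") real_algebra_1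
begin

lift_definition zero_clifford :: "'a clifford" is "\<lambda>_. 0" .

lift_definition one_clifford :: "'a clifford" is "\<lambda>A. if A = {} then 1 else 0" .

lift_definition plus_clifford :: "'a clifford \<Rightarrow> 'a clifford \<Rightarrow> 'a clifford"
  is "\<lambda>x y A. x A + y A" .

lift_definition uminus_clifford :: "'a clifford \<Rightarrow> 'a clifford" is "\<lambda>x A. - x A" .

lift_definition minus_clifford :: "'a clifford \<Rightarrow> 'a clifford \<Rightarrow> 'a clifford"
  is "\<lambda>x y A. x A - y A" .

lift_definition scaleR_clifford :: "real \<Rightarrow> 'a clifford \<Rightarrow> 'a clifford"
  is "\<lambda>c x A. c * x A" .

text \<open>For each \<open>A\<close>, the only \<open>B\<close> for which \<open>e\<^sub>A e\<^sub>B\<close> is a multiple of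
  \<open>e\<^sub>C\<close> is the symmetric difference of \<open>A\<close> and \<open>C\<close>.\<close>

lift_definition times_clifford :: "'a clifford \<Rightarrow> 'a clifford \<Rightarrow> 'a clifford"
  is "\<lambda>x y C. \<Sum>A\<in>UNIV. blade_sign A (sym_diff A C) * x A * y (sym_diff A C)" .

instance
proof
  fix x y z :: "'a clifford" and a b :: real
  show "x + y + z = x + (y + z)" "x + y = y + x" "0 + x = x" "- x + x = 0" "x - y = x + - y"
    by (transfer, simp add: algebra_simps)+
  show "a *\<^sub>R (x + y) = a *\<^sub>R x + a *\<^sub>R y" "(a + b) *\<^sub>R x = a *\<^sub>R x + b *\<^sub>R x"
    "a *\<^sub>R b *\<^sub>R x = (a * b) *\<^sub>R x" "1 *\<^sub>R x = x"
    by (transfer, simp add: algebra_simps)+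
  show "(x + y) * z = x * z + y * z" "x * (y + z) = x * y + x * z"
    by (transfer, simp add: algebra_simps sum.distrib)+
  show "a *\<^sub>R x * y = a *\<^sub>R (x * y)" "x * a *\<^sub>R y = a *\<^sub>R (x * y)"
    by (transfer, simp add: sum_distrib_left mult_ac)+
  show "(0::'a clifford) \<noteq> 1"
    by transfer (metis zero_neq_one)
  show "1 * x = x"
    by transfer (simp add: if_distrib[of "\<lambda>t. _ * t"] if_distrib[of "\<lambda>t. t * _"] cong: if_cong)
  show "x * 1 = x"
  proof (transfer, rule ext)
    fix x :: "'a set \<Rightarrow> real" and C :: "'a set"
    have "(\<Sum>A\<in>UNIV. blade_sign A (sym_diff A C) * x A * (if sym_diff A C = {} then 1 else 0))
        = (\<Sum>A\<in>UNIV. if A = C then x A else 0)"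
      by (rule sum.cong) auto
    then show "(\<Sum>A\<in>UNIV. blade_sign A (sym_diff A C) * x A * (if sym_diff A C = {} then 1 else 0))
        = x C"
      by simp
  qed
  show "x * y * z = x * (y * z)"
  proof (transfer, rule ext)
    fix x y z :: "'a set \<Rightarrow> real" and D :: "'a set"
    have aux: "sym_diff A (sym_diff A B) = B" for A B :: "'a set" by auto
    have assoc: "sym_diff (sym_diff A B) D = sym_diff B (sym_diff A D)" for A B :: "'a set" by auto
    let ?s = "blade_sign :: 'a set \<Rightarrow> 'a set \<Rightarrow> real"
    have sign: "?s A B * ?s (sym_diff A B) (sym_diff (sym_diff A B) D)
        = ?s A (sym_diff A D) * ?s B (sym_diff B (sym_diff A D))" for A B
    proof -
      have "?s A (sym_diff A D) = ?s A B * ?s A (sym_diff B (sym_diff A D))"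
        by (subst blade_sign_sym_diff_right[symmetric], subst aux) (rule refl)
      then show ?thesis
        by (simp only: blade_sign_sym_diff_left assoc mult.assoc)
    qed
    have "(\<Sum>C\<in>UNIV. ?s C (sym_diff C D) *
            (\<Sum>A\<in>UNIV. ?s A (sym_diff A C) * x A * y (sym_diff A C)) * z (sym_diff C D))
        = (\<Sum>A\<in>UNIV. \<Sum>C\<in>UNIV. ?s C (sym_diff C D) *
            (?s A (sym_diff A C) * x A * y (sym_diff A C)) * z (sym_diff C D))"
      by (subst sum.swap) (simp only: sum_distrib_left sum_distrib_right)
    also have "\<dots> = (\<Sum>A\<in>UNIV. \<Sum>B\<in>UNIV.
          ?s (sym_diff A B) (sym_diff (sym_diff A B) D) * (?s A (sym_diff A (sym_diff A B)) * x A *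
            y (sym_diff A (sym_diff A B))) * z (sym_diff (sym_diff A B) D))"
      by (rule sum.cong[OF refl], rule sum_sym_diff_reindex[symmetric])
    also have "\<dots> = (\<Sum>A\<in>UNIV. \<Sum>B\<in>UNIV.
          (?s A B * ?s (sym_diff A B) (sym_diff (sym_diff A B) D)) * (x A * y B *
            z (sym_diff (sym_diff A B) D)))"
      by (simp only: aux mult_ac)
    also have "\<dots> = (\<Sum>A\<in>UNIV. ?s A (sym_diff A D) * x A *
            (\<Sum>B\<in>UNIV. ?s B (sym_diff B (sym_diff A D)) * y B * z (sym_diff B (sym_diff A D))))"
      by (simp only: sign) (simp only: assoc sum_distrib_left mult_ac)
    finally show "(\<Sum>C\<in>UNIV. ?s C (sym_diff C D) *
            (\<Sum>A\<in>UNIV. ?s A (sym_diff A C) * x A * y (sym_diff A C)) * z (sym_diff C D))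
        = (\<Sum>A\<in>UNIV. ?s A (sym_diff A D) * x A *
            (\<Sum>B\<in>UNIV. ?s B (sym_diff B (sym_diff A D)) * y B * z (sym_diff B (sym_diff A D))))" .
  qed
qed

end

lift_definition blade :: "'n::{finite,linorder} set \<Rightarrow> 'n clifford"
  is "\<lambda>A B. if B = A then 1 else 0" .

text \<open>The topology, used for the convergence of series, is the Euclidean one.\<close>

instantiation clifford :: ("{finite,linorder}") euclidean_space
begin

definition inner_clifford :: "'a clifford \<Rightarrow> 'a clifford \<Rightarrow> real" where
  "inner_clifford x y = (\<Sum>A\<in>UNIV. coef x A * coef y A)"

definition norm_clifford :: "'a clifford \<Rightarrow> real" where
  "norm_clifford x = sqrt (inner x x)"

definition dist_clifford :: "'a clifford \<Rightarrow> 'a clifford \<Rightarrow> real" where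
  "dist_clifford x y = norm (x - y)"

definition sgn_clifford :: "'a clifford \<Rightarrow> 'a clifford" where
  "sgn_clifford x = inverse (norm x) *\<^sub>R x"

definition uniformity_clifford :: "('a clifford \<times> 'a clifford) filter" where
  "uniformity_clifford = (INF e\<in>{0<..}. principal {(x, y). dist x y < e})"

definition open_clifford :: "'a clifford set \<Rightarrow> bool" where
  "open_clifford U \<longleftrightarrow> (\<forall>x\<in>U. \<forall>\<^sub>F (x', y) in uniformity. x' = x \<longrightarrow> y \<in> U)"

definition Basis_clifford :: "'a clifford set" where
  "Basis_clifford = range blade"

instance
proof
  fix x y z :: "'a clifford" and r :: real and U :: "'a clifford set"
  show "dist x y = norm (x - y)" by (rule dist_clifford_def)
  show "sgn x = inverse (norm x) *\<^sub>R x" by (rule sgn_clifford_def)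
  show "uniformity = (INF e\<in>{0<..}. principal {(x::'a clifford, y). dist x y < e})"
    by (rule uniformity_clifford_def)
  show "open U \<longleftrightarrow> (\<forall>x\<in>U. \<forall>\<^sub>F (x', y) in uniformity. x' = x \<longrightarrow> y \<in> U)"
    by (rule open_clifford_def)
  show "inner x y = inner y x"
    by (simp add: inner_clifford_def mult.commute)
  show "inner (x + y) z = inner x z + inner y z"
    by (simp add: inner_clifford_def plus_clifford.rep_eq algebra_simps sum.distrib)
  show "inner (r *\<^sub>R x) y = r * inner x y"
    by (simp add: inner_clifford_def scaleR_clifford.rep_eq sum_distrib_left mult_ac)
  show "0 \<le> inner x x"
    by (simp add: inner_clifford_def sum_nonneg)
  show zero: "inner x x = 0 \<longleftrightarrow> x = 0"
    by (auto simp: inner_clifford_def sum_nonneg_eq_0_iff zero_clifford.rep_eq intro: clifford_eqI)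
  show "norm x = sqrt (inner x x)" by (rule norm_clifford_def)
  have inner_blade: "inner v (blade A) = coef v A" for v :: "'a clifford" and A
    by (simp add: inner_clifford_def blade.rep_eq if_distrib[of "\<lambda>t. _ * t"] cong: if_cong)
  show "(Basis :: 'a clifford set) \<noteq> {}" "finite (Basis :: 'a clifford set)"
    by (simp_all add: Basis_clifford_def)
  show "inner u v = (if u = v then 1 else 0)" if "u \<in> Basis" "v \<in> Basis" for u v :: "'a clifford"
    using that by (auto simp: Basis_clifford_def inner_blade blade.rep_eq)
  show "(\<forall>u\<in>Basis. inner x u = 0) \<longleftrightarrow> x = 0"
    by (auto simp: Basis_clifford_def inner_blade zero_clifford.rep_eq intro: clifford_eqI)
qed

end

definition gen :: "'n::{finite,linorder} \<Rightarrow> 'n clifford" where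
  "gen i = blade {i}"

lemma blade_mult: "blade A * blade B = blade_sign A B *\<^sub>R blade (sym_diff A B)"
proof (transfer, rule ext)
  fix A B C :: "'a set"
  have "(\<Sum>A'\<in>UNIV. blade_sign A' (sym_diff A' C) * (if A' = A then 1 else 0) *
          (if sym_diff A' C = B then 1 else 0))
      = (\<Sum>A'\<in>UNIV. if A' = A then blade_sign A (sym_diff A C) *
          (if sym_diff A C = B then 1 else 0) else 0)"
    by (rule sum.cong) auto
  also have "\<dots> = blade_sign A (sym_diff A C) * (if sym_diff A C = B then 1 else 0)"
    by simp
  also have "\<dots> = blade_sign A B * (if C = sym_diff A B then 1 else 0)"
  proof (cases "C = sym_diff A B")
    case True
    then have "sym_diff A C = B" by auto
    with True show ?thesis by (simp only: if_True simp_thms)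
  next
    case False
    then have "sym_diff A C \<noteq> B" by auto
    with False show ?thesis by simp
  qed
  finally show "(\<Sum>A'\<in>UNIV. blade_sign A' (sym_diff A' C) * (if A' = A then 1 else 0) *
          (if sym_diff A' C = B then 1 else 0))
      = blade_sign A B * (if C = sym_diff A B then 1 else 0)" .
qed

lemma blade_empty: "blade {} = 1"
  by transfer auto

lemma gen_relation:
  "gen i * gen j + gen j * gen i = (if i = j then - 2 else 0)"
proof (cases "i = j")
  case True
  then show ?thesis
    by (simp add: gen_def blade_mult blade_sign_def blade_empty)
next
  case False
  then have "sym_diff {i} {j} = sym_diff {j} {i}" by auto
  with False show ?thesis
    by (auto simp: gen_def blade_mult blade_sign_def insert_commute)
qed

definition paravectors :: "'n::{finite,linorder} clifford set" where
  "paravectors = {x0 *\<^sub>R 1 + (\<Sum>i\<in>UNIV. x i *\<^sub>R gen i) | x0 x. True}"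

text \<open>The two-sided inverse in an arbitrary ring, meaningful for invertible elements only.\<close>

definition ring_inverse :: "'a::ring_1 \<Rightarrow> 'a" where
  "ring_inverse x = (THE y. x * y = 1 \<and> y * x = 1)"

lemma ring_inverse_eqI:
  fixes x y :: "'a::ring_1"
  assumes "x * y = 1" "y * x = 1"
  shows "ring_inverse x = y"
  unfolding ring_inverse_def
  using assms by (intro the_equality) (auto, metis mult.assoc mult_1_left mult_1_right)

lemma gen_sum_square:
  "(\<Sum>i\<in>UNIV. x i *\<^sub>R gen i) * (\<Sum>i\<in>UNIV. x i *\<^sub>R gen i)
     = - (\<Sum>i\<in>UNIV. (x i)\<^sup>2) *\<^sub>R 1"
    (is "?v * ?v = _")
proof -
  have 1: "?v * ?v = (\<Sum>i\<in>UNIV. \<Sum>j\<in>UNIV. (x i * x j) *\<^sub>R (gen i * gen j))"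
    by (simp add: sum_product mult.commute)
  have 2: "?v * ?v = (\<Sum>i\<in>UNIV. \<Sum>j\<in>UNIV. (x i * x j) *\<^sub>R (gen j * gen i))"
    by (subst 1, subst sum.swap) (simp add: mult.commute)
  have "?v * ?v + ?v * ?v
      = (\<Sum>i\<in>UNIV. \<Sum>j\<in>UNIV. (x i * x j) *\<^sub>R (gen i * gen j + gen j * gen i))"
    by (subst (1) 1, subst 2) (simp add: sum.distrib scaleR_add_right)
  also have "\<dots> = (\<Sum>i\<in>UNIV. \<Sum>j\<in>UNIV. if i = j then (x i * x j) *\<^sub>R (- 2) else 0)"
    by (intro sum.cong refl) (simp add: gen_relation)
  also have "\<dots> = (\<Sum>i\<in>UNIV. (x i)\<^sup>2 *\<^sub>R (- 2))"
    by (simp add: power2_eq_square)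
  also have "\<dots> = (\<Sum>i\<in>UNIV. (x i)\<^sup>2) *\<^sub>R (- 2)"
    by (rule scaleR_sum_left[symmetric])
  also have "\<dots> = 2 *\<^sub>R (- (\<Sum>i\<in>UNIV. (x i)\<^sup>2) *\<^sub>R 1)"
  proof -
    have "(- 2 :: 'a clifford) = (- 2) *\<^sub>R 1"
      by (simp only: scaleR_minus_left scaleR_2 one_add_one)
    then show ?thesis
      by (simp only: scaleR_scaleR mult_minus_left mult_minus_right mult.commute)
  qed
  finally have "2 *\<^sub>R (?v * ?v) = 2 *\<^sub>R (- (\<Sum>i\<in>UNIV. (x i)\<^sup>2) *\<^sub>R 1)"
    by (simp only: scaleR_2)
  then show ?thesis
    by (simp only: scaleR_cancel_left) simp
qed

lemma paravector_invertible:
  assumes "x \<in> paravectors" "x \<noteq> 0"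
  shows "x * ring_inverse x = 1" "ring_inverse x * x = 1" "ring_inverse x \<in> paravectors"
proof -
  obtain x0 xs where x: "x = x0 *\<^sub>R 1 + (\<Sum>i\<in>UNIV. xs i *\<^sub>R gen i)"
    using assms(1) by (auto simp: paravectors_def)
  define v where "v = (\<Sum>i\<in>UNIV. xs i *\<^sub>R gen i :: 'a clifford)"
  define c where "c = x0\<^sup>2 + (\<Sum>i\<in>UNIV. (xs i)\<^sup>2)"
  have vv: "v * v = - (\<Sum>i\<in>UNIV. (xs i)\<^sup>2) *\<^sub>R 1"
    unfolding v_def by (rule gen_sum_square)
  have c0: "c \<noteq> 0"
  proof
    assume "c = 0"
    moreover have "(\<Sum>i\<in>UNIV. (xs i)\<^sup>2) \<ge> 0" by (rule sum_nonneg) simp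
    ultimately have "x0\<^sup>2 = 0" "(\<Sum>i\<in>UNIV. (xs i)\<^sup>2) = 0"
      unfolding c_def using zero_le_power2[of x0] by linarith+
    then have "x0 = 0" "\<forall>i. xs i = 0" by (simp_all add: sum_nonneg_eq_0_iff)
    with x assms(2) show False by simp
  qed
  define y where "y = inverse c *\<^sub>R (x0 *\<^sub>R 1 - v)"
  have xv: "x = x0 *\<^sub>R 1 + v" by (simp add: x v_def)
  have c1: "(x0 * x0) *\<^sub>R 1 - v * v = c *\<^sub>R 1"
    by (simp add: vv c_def power2_eq_square scaleR_add_left)
  have xy: "x * y = 1"
  proof -
    have "x * y = inverse c *\<^sub>R ((x0 * x0) *\<^sub>R 1 - v * v)"
      by (simp add: xv y_def algebra_simps)
    then show ?thesis using c0 by (simp add: c1)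
  qed
  have yx: "y * x = 1"
  proof -
    have "y * x = inverse c *\<^sub>R ((x0 * x0) *\<^sub>R 1 - v * v)"
      by (simp add: xv y_def algebra_simps)
    then show ?thesis using c0 by (simp add: c1)
  qed
  have y: "ring_inverse x = y" using xy yx by (rule ring_inverse_eqI)
  show "x * ring_inverse x = 1" "ring_inverse x * x = 1"
    using xy yx y by simp_all
  have "y = (inverse c * x0) *\<^sub>R 1 + (\<Sum>i\<in>UNIV. (- inverse c * xs i) *\<^sub>R gen i)"
    by (simp add: y_def v_def scaleR_diff_right scaleR_sum_right sum_negf)
  then show "ring_inverse x \<in> paravectors"
    unfolding y paravectors_def mem_Collect_eq
    by (intro exI[of _ "inverse c * x0"] exI[of _ "\<lambda>i. - inverse c * xs i"]) simp
qed

section \<open>Lattices, the zeta function and translation operators\<close>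

definition int_lattice :: "nat \<Rightarrow> (nat \<Rightarrow> 'a::real_vector) \<Rightarrow> 'a set" where
  "int_lattice N v = {(\<Sum>j=1..N. real_of_int (k j) *\<^sub>R v j) | k. True}"

text \<open>Here \<open>w\<close> is an enumeration of the period lattice with \<open>w 0 = 0\<close>; the series therefore
  starts at \<open>w (Suc 0)\<close>.\<close>

definition zeta ::
  "nat \<Rightarrow> (nat \<Rightarrow> 'n::{finite,linorder} clifford) \<Rightarrow> 'n clifford \<Rightarrow> 'n clifford" where
  "zeta N w x = ring_inverse x +
     (\<Sum>p. ring_inverse (x - w (Suc p)) +
        (\<Sum>\<mu><N. (ring_inverse (w (Suc p)) * x) ^ \<mu> * ring_inverse (w (Suc p))))"

definition translate :: "'a::plus \<Rightarrow> ('a \<Rightarrow> 'b) \<Rightarrow> 'a \<Rightarrow> 'b" where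
  "translate a \<phi> = (\<lambda>x. \<phi> (x + a))"

definition id_plus_translate :: "'a::plus \<Rightarrow> ('a \<Rightarrow> 'b::plus) \<Rightarrow> 'a \<Rightarrow> 'b" where
  "id_plus_translate a \<phi> = (\<lambda>x. \<phi> x + translate a \<phi> x)"

definition id_minus_translate :: "'a::plus \<Rightarrow> ('a \<Rightarrow> 'b::minus) \<Rightarrow> 'a \<Rightarrow> 'b" where
  "id_minus_translate a \<phi> = (\<lambda>x. \<phi> x - translate a \<phi> x)"

text \<open>The factors commute, so composing them in the order of their indices is no restriction.\<close>

lemma id_minus_translate_commute:
  fixes a b :: "'a::ab_semigroup_add" and \<phi> :: "'a \<Rightarrow> 'b::ab_group_add"
  shows "id_minus_translate a (id_minus_translate b \<phi>) = id_minus_translate b (id_minus_translate a \<phi>)"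
  by (simp add: id_minus_translate_def translate_def fun_eq_iff algebra_simps)

definition S_fun ::
  "nat \<Rightarrow> (nat \<Rightarrow> 'n::{finite,linorder} clifford) \<Rightarrow> (nat \<Rightarrow> 'n clifford) \<Rightarrow> nat \<Rightarrow> 'n clifford \<Rightarrow> 'n clifford" where
  "S_fun N \<omega> w i =
     (id_plus_translate (\<omega> i) \<circ>
       foldr (\<circ>) (map (\<lambda>j. id_minus_translate (\<omega> j)) (filter (\<lambda>j. j \<noteq> i) [1..<Suc N])) id)
     (zeta N w)"

end

theory Submission
  imports Defs
begin

text \<open>
  Write \<open>N = 2 * m + 2\<close> and let \<open>Z\<close> be the zeta function after the \<open>N - 1\<close> differences
  \<open>I - E\<^sub>j\<close> with \<open>j \<noteq> i\<close>. Then \<open>S\<^sub>i(x) = Z(x) + Z(x + \<omega>\<^sub>i)\<close>, and it suffices that \<open>Z\<close> has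
  all the periods \<open>2 \<omega>\<^sub>k\<close> (\<open>zeta_difference_periodic\<close>): for the period \<open>\<omega>\<^sub>i\<close> of \<open>S\<^sub>i\<close>, the
  shift by \<open>\<omega>\<^sub>i\<close> exchanges the two summands up to the period \<open>2 \<omega>\<^sub>i\<close> of \<open>Z\<close>.

  The zeta term of a lattice point \<open>w\<close> is the Cauchy-type kernel \<open>(x - w)\<^sup>-\<^sup>1\<close> plus a
  polynomial of degree at most \<open>N - 1\<close> in \<open>x\<close>. The \<open>N - 1\<close> differences turn this polynomial
  into a constant (\<open>poly_deg_nabla\<close>) and the kernel into some \<open>g(x - w)\<close> with the same \<open>g\<close> for
  all \<open>w\<close>. Hence \<open>Z(x + 2 \<omega>\<^sub>k) - Z(x)\<close> is the sum over \<open>w\<close> of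
  \<open>g(x + 2 \<omega>\<^sub>k - w) - g(x - w)\<close>. Along each line of the lattice in direction \<open>\<omega>\<^sub>k\<close> this
  telescopes, and since \<open>g\<close> vanishes at infinity the sum is \<open>0\<close> (\<open>lattice_telescope\<close>).

  Applying the differences termwise and summing line by line requires unconditional convergence
  of the zeta series. By the geometric sum its terms are \<open>(w\<^sup>-\<^sup>1 x)\<^sup>N (x - w)\<^sup>-\<^sup>1\<close>
  (\<open>kernel_remainder\<close>), hence \<open>O(norm w ^ -(N + 1))\<close>, which is summable over a lattice of rank
  \<open>N\<close> (\<open>summable_on_lattice_norm\<close>).
\<close>

section \<open>Unordered sums\<close>

text \<open>A finite partial sum lies in a finite box, where the sum of the products factors and is
  bounded by the product of the full sums.\<close>

lemma summable_on_prod_PiE: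
  fixes f :: "'i \<Rightarrow> 'b \<Rightarrow> real"
  assumes A: "finite A" and nonneg: "\<And>i b. i \<in> A \<Longrightarrow> b \<in> B i \<Longrightarrow> f i b \<ge> 0"
    and f: "\<And>i. i \<in> A \<Longrightarrow> f i summable_on B i"
  shows "(\<lambda>g. \<Prod>i\<in>A. f i (g i)) summable_on PiE A B"
proof (rule nonneg_bdd_above_summable_on)
  show "(\<Prod>i\<in>A. f i (g i)) \<ge> 0" if "g \<in> PiE A B" for g
    using that nonneg by (intro prod_nonneg) auto
  show "bdd_above (sum (\<lambda>g. \<Prod>i\<in>A. f i (g i)) ` {F. F \<subseteq> PiE A B \<and> finite F})"
  proof (rule bdd_aboveI2)
    fix F assume "F \<in> {F. F \<subseteq> PiE A B \<and> finite F}"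
    then have F: "F \<subseteq> PiE A B" "finite F" by auto
    define B' where "B' i = (\<lambda>g. g i) ` F" for i
    have B': "finite (B' i)" "i \<in> A \<Longrightarrow> B' i \<subseteq> B i" for i
      using F by (auto simp: B'_def)
    have sub: "F \<subseteq> PiE A B'"
      using F by (auto simp: B'_def PiE_def)
    have "sum (\<lambda>g. \<Prod>i\<in>A. f i (g i)) F \<le> (\<Sum>g\<in>PiE A B'. \<Prod>i\<in>A. f i (g i))"
    proof (rule sum_mono2[OF _ sub])
      show "finite (PiE A B')" using A B' by (intro finite_PiE)
      show "(\<Prod>i\<in>A. f i (g i)) \<ge> 0" if "g \<in> PiE A B' - F" for g
        using that nonneg B'(2) by (intro prod_nonneg) (auto simp: PiE_def Pi_def subset_iff)
    qed
    also have "\<dots> = (\<Prod>i\<in>A. sum (f i) (B' i))"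
      using A B' by (subst prod_sum_PiE) auto
    also have "\<dots> \<le> (\<Prod>i\<in>A. infsum (f i) (B i))"
      using nonneg f B' by (intro prod_mono conjI sum_nonneg finite_sum_le_infsum) (use nonneg B'(2) in \<open>blast+\<close>)
    finally show "sum (\<lambda>g. \<Prod>i\<in>A. f i (g i)) F \<le> (\<Prod>i\<in>A. infsum (f i) (B i))" .
  qed
qed

lemma summable_on_int_powr:
  fixes s :: real
  assumes "s < -1"
  shows "(\<lambda>n::int. (1 + \<bar>real_of_int n\<bar>) powr s) summable_on UNIV"
proof -
  let ?f = "\<lambda>n::int. (1 + \<bar>real_of_int n\<bar>) powr s"
  have "summable (\<lambda>n. real (Suc n) powr s)"
    using assms by (subst summable_Suc_iff) (simp add: summable_real_powr_iff)
  then have nat: "(\<lambda>n. real (Suc n) powr s) summable_on UNIV"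
    by (subst summable_on_UNIV_nonneg_real_iff) auto
  have "?f summable_on range int" "?f summable_on range (\<lambda>n. - int n)"
    using nat by (subst summable_on_reindex, auto simp: inj_on_def o_def add.commute)+
  then have "?f summable_on (range int \<union> range (\<lambda>n. - int n))"
    by (rule summable_on_union)
  moreover have "range int \<union> range (\<lambda>n. - int n) = UNIV"
  proof -
    have "k \<in> range int \<union> range (\<lambda>n. - int n)" for k
      by (cases k rule: int_cases2) auto
    then show ?thesis by blast
  qed
  ultimately show ?thesis by simp
qed

text \<open>The sum over \<open>-m..m\<close> collapses to two boundary values, one at each end.\<close>

lemma has_sum_int_telescope:
  fixes f :: "int \<Rightarrow> 'a::real_normed_vector"
  assumes sum: "((\<lambda>n. f (n - 1) - f n) has_sum s) UNIV"
    and top: "(f \<longlongrightarrow> 0) at_top" and bot: "(f \<longlongrightarrow> 0) at_bot"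
  shows "s = 0"
proof -
  have lim: "filterlim (\<lambda>m. {- int m..int m}) (finite_subsets_at_top UNIV) sequentially"
    unfolding filterlim_finite_subsets_at_top
  proof safe
    fix X :: "int set" assume X: "finite X"
    define M where "M = (\<Sum>x\<in>X. nat \<bar>x\<bar>)"
    have M: "nat \<bar>x\<bar> \<le> M" if "x \<in> X" for x
      unfolding M_def using X that by (intro member_le_sum) auto
    show "\<forall>\<^sub>F m in sequentially. finite {- int m..int m} \<and> X \<subseteq> {- int m..int m} \<and> {- int m..int m} \<subseteq> UNIV"
      using eventually_ge_at_top[of M]
    proof eventually_elim
      case (elim m)
      have "x \<in> {- int m..int m}" if "x \<in> X" for x
        using M[OF that] elim by auto
      then show ?case by auto
    qed
  qed
  have "(\<lambda>m. \<Sum>n\<in>{- int m..int m}. f (n - 1) - f n) \<longlonglongrightarrow> s"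
    using sum lim unfolding has_sum_def by (rule filterlim_compose)
  moreover have "(\<Sum>n\<in>{- int m..int m}. f (n - 1) - f n) = f (- int m - 1) - f (int m)" for m
  proof (induction m)
    case (Suc m)
    have "{- int (Suc m)..int (Suc m)} = insert (- int m - 1) (insert (int m + 1) {- int m..int m})"
      by auto
    then show ?case by (simp add: Suc algebra_simps)
  qed auto
  moreover have "(\<lambda>m. f (- int m - 1) - f (int m)) \<longlonglongrightarrow> 0 - 0"
  proof (intro tendsto_diff)
    have "filterlim (\<lambda>m. - int m - 1) at_bot sequentially"
      unfolding filterlim_at_bot
    proof
      fix Z :: int
      show "\<forall>\<^sub>F m in sequentially. - int m - 1 \<le> Z"
        using eventually_ge_at_top[of "nat \<bar>Z\<bar>"] by eventually_elim auto
    qed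
    with bot show "(\<lambda>m. f (- int m - 1)) \<longlonglongrightarrow> 0" by (rule filterlim_compose)
    show "(\<lambda>m. f (int m)) \<longlonglongrightarrow> 0"
      using top filterlim_int_sequentially by (rule filterlim_compose)
  qed
  ultimately show ?thesis
    using LIMSEQ_unique by fastforce
qed

section \<open>Lattices with a dual basis\<close>

text \<open>The coordinate functionals dual to the basis carry linear independence: they recover the
  integer coefficients of a lattice point, and since they are bounded they compare these
  coefficients with the norm.\<close>

locale based_lattice =
  fixes N :: nat and v :: "nat \<Rightarrow> 'a::euclidean_space" and coord :: "nat \<Rightarrow> 'a \<Rightarrow> real"
  assumes linear_coord: "j \<in> {1..N} \<Longrightarrow> linear (coord j)"
    and coord_basis: "j \<in> {1..N} \<Longrightarrow> l \<in> {1..N} \<Longrightarrow> coord j (v l) = (if l = j then 1 else 0)"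
begin

abbreviation lattice :: "'a set" where "lattice \<equiv> int_lattice N v"

lemma coord_sum:
  assumes "j \<in> {1..N}"
  shows "coord j (\<Sum>l=1..N. c l *\<^sub>R v l) = c j"
proof -
  have "coord j (\<Sum>l=1..N. c l *\<^sub>R v l) = (\<Sum>l=1..N. c l * coord j (v l))"
    using linear_coord[OF assms] by (simp add: linear_sum linear_cmul)
  also have "\<dots> = (\<Sum>l=1..N. if l = j then c j else 0)"
    using assms by (intro sum.cong) (auto simp: coord_basis)
  finally show ?thesis using assms by simp
qed

lemma coord_lattice:
  assumes "w \<in> lattice" "j \<in> {1..N}"
  shows "coord j w = real_of_int \<lfloor>coord j w\<rfloor>"
proof -
  obtain k where "w = (\<Sum>l=1..N. real_of_int (k l) *\<^sub>R v l)"
    using assms(1) by (auto simp: int_lattice_def)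
  then show ?thesis by (simp only: coord_sum[OF assms(2)] floor_of_int)
qed

lemma lattice_expand:
  assumes "w \<in> lattice"
  shows "w = (\<Sum>j=1..N. coord j w *\<^sub>R v j)"
proof -
  obtain k where w: "w = (\<Sum>l=1..N. real_of_int (k l) *\<^sub>R v l)"
    using assms by (auto simp: int_lattice_def)
  show ?thesis by (subst (1) w, rule sum.cong) (simp_all only: w coord_sum)
qed

lemma inj_on_coords: "inj_on (\<lambda>w. \<lambda>j\<in>{1..N}. \<lfloor>coord j w\<rfloor>) lattice"
proof (rule inj_onI)
  fix w w' assume w: "w \<in> lattice" "w' \<in> lattice"
    and eq: "(\<lambda>j\<in>{1..N}. \<lfloor>coord j w\<rfloor>) = (\<lambda>j\<in>{1..N}. \<lfloor>coord j w'\<rfloor>)"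
  have "coord j w = coord j w'" if "j \<in> {1..N}" for j
    using fun_cong[OF eq, of j] that coord_lattice[OF w(1) that] coord_lattice[OF w(2) that] by simp
  then have "(\<Sum>j=1..N. coord j w *\<^sub>R v j) = (\<Sum>j=1..N. coord j w' *\<^sub>R v j)"
    by (intro sum.cong) auto
  then show "w = w'" using lattice_expand w by metis
qed

lemma coord_bound:
  obtains M where "M > 0" "\<And>j w. j \<in> {1..N} \<Longrightarrow> \<bar>coord j w\<bar> \<le> M * norm w"
proof -
  have "\<exists>B>0. \<forall>w. \<bar>coord j w\<bar> \<le> B * norm w" if "j \<in> {1..N}" for j
    using linear_bounded_pos[OF linear_coord[OF that]] by (metis real_norm_def)
  then have "\<forall>j\<in>{1..N}. \<exists>B>0. \<forall>w. \<bar>coord j w\<bar> \<le> B * norm w" by blast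
  from bchoice[OF this] obtain B where "\<forall>j\<in>{1..N}. B j > 0 \<and> (\<forall>w. \<bar>coord j w\<bar> \<le> B j * norm w)" ..
  then have B: "B j > 0" "\<bar>coord j w\<bar> \<le> B j * norm w" if "j \<in> {1..N}" for j w
    using that by blast+
  define M where "M = 1 + (\<Sum>j=1..N. B j)"
  have "M > 0" unfolding M_def using B(1) by (intro add_pos_nonneg sum_nonneg) (auto intro: less_imp_le)
  moreover have "\<bar>coord j w\<bar> \<le> M * norm w" if j: "j \<in> {1..N}" for j w
  proof -
    have "B j \<le> (\<Sum>j=1..N. B j)"
      using j B(1) by (intro member_le_sum) (auto intro: less_imp_le)
    then have "B j \<le> M" by (simp add: M_def)
    then show ?thesis using B(2)[OF j, of w] mult_right_mono[of "B j" M "norm w"] norm_ge_zero[of w] by linarith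
  qed
  ultimately show ?thesis by (rule that)
qed

lemma finite_lattice_ball: "finite {w \<in> lattice. norm w \<le> R}"
proof -
  obtain M where M: "M > 0" "\<And>j w. j \<in> {1..N} \<Longrightarrow> \<bar>coord j w\<bar> \<le> M * norm w"
    using coord_bound by blast
  let ?c = "\<lambda>w. \<lambda>j\<in>{1..N}. \<lfloor>coord j w\<rfloor>" and ?P = "{w \<in> lattice. norm w \<le> R}"
  have "?c ` ?P \<subseteq> PiE {1..N} (\<lambda>_. {- \<lceil>M * R\<rceil>..\<lceil>M * R\<rceil>})"
  proof clarsimp
    fix w j assume w: "w \<in> lattice" "norm w \<le> R" and j: "Suc 0 \<le> j" "j \<le> N"
    have "\<bar>real_of_int \<lfloor>coord j w\<rfloor>\<bar> \<le> M * R"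
      using order_trans[OF M(2)[of j w] mult_left_mono[OF w(2)]] coord_lattice[OF w(1), of j] j M(1) by auto
    then show "- \<lceil>M * R\<rceil> \<le> \<lfloor>coord j w\<rfloor> \<and> \<lfloor>coord j w\<rfloor> \<le> \<lceil>M * R\<rceil>" by linarith
  qed
  then have "finite (?c ` ?P)" by (rule finite_subset) (simp add: finite_PiE)
  moreover have "inj_on ?c ?P" using inj_on_coords by (rule inj_on_subset) auto
  ultimately show ?thesis by (rule finite_imageD)
qed

text \<open>For \<open>w \<noteq> 0\<close> every factor \<open>1 + \<bar>k\<^sub>j\<bar>\<close>, with \<open>k\<^sub>j\<close> the
  coordinates of \<open>w\<close>, is at most a constant times \<open>norm w\<close>. Distributing the exponent
  \<open>N + 1\<close> evenly over the \<open>N\<close> coordinates therefore bounds \<open>norm w ^ -(N + 1)\<close> by the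
  product of the \<open>(1 + \<bar>k\<^sub>j\<bar>) powr -(1 + 1 / N)\<close>, and each one-dimensional sum converges.\<close>

lemma summable_on_lattice_norm:
  assumes "N \<ge> 1"
  shows "(\<lambda>w. inverse (norm w ^ Suc N)) summable_on (lattice - {0})"
proof -
  obtain M where M: "M > 0" "\<And>j w. j \<in> {1..N} \<Longrightarrow> \<bar>coord j w\<bar> \<le> M * norm w"
    using coord_bound by blast
  \<comment> \<open>Chosen such that \<open>s * N = - (N + 1)\<close> and \<open>s < -1\<close>.\<close>
  define s where "s = - (1 + 1 / real N)"
  have s: "s < -1" using assms by (simp add: s_def)
  let ?c = "\<lambda>w. \<lambda>j\<in>{1..N}. \<lfloor>coord j w\<rfloor>"
  let ?h = "\<lambda>k::nat \<Rightarrow> int. \<Prod>j=1..N. (1 + \<bar>real_of_int (k j)\<bar>) powr s"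
  have "?h summable_on (PiE {1..N} (\<lambda>_. UNIV))"
    using summable_on_int_powr[OF s] by (intro summable_on_prod_PiE) auto
  then have "?h summable_on (?c ` (lattice - {0}))"
    by (rule summable_on_subset_banach) auto
  then have "(\<lambda>w. ?h (?c w)) summable_on (lattice - {0})"
    by (subst (asm) summable_on_reindex) (rule inj_on_subset[OF inj_on_coords], auto simp: o_def)
  then have "(\<lambda>w. (2 * M) ^ Suc N * ?h (?c w)) summable_on (lattice - {0})"
    by (rule summable_on_cmult_right)
  then show ?thesis
  proof (rule summable_on_comparison_test)
    fix w assume w: "w \<in> lattice - {0}"
    have wpos: "norm w > 0" using w by simp
    obtain l where l: "l \<in> {1..N}" "coord l w \<noteq> 0"
    proof (rule ccontr)
      assume "\<not> thesis"
      then have "coord j w *\<^sub>R v j = 0" if "j \<in> {1..N}" for j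
        using that \<open>\<And>l. l \<in> {1..N} \<Longrightarrow> coord l w \<noteq> 0 \<Longrightarrow> thesis\<close> by fastforce
      then have "(\<Sum>j=1..N. coord j w *\<^sub>R v j) = 0" by (rule sum.neutral[OF ballI])
      with lattice_expand[of w] w show False by simp
    qed
    have cl: "coord l w = real_of_int \<lfloor>coord l w\<rfloor>" using w l by (intro coord_lattice) auto
    then have "\<lfloor>coord l w\<rfloor> \<noteq> 0" using l(2) by (metis of_int_0)
    then have "1 \<le> \<bar>\<lfloor>coord l w\<rfloor>\<bar>" by linarith
    then have "1 \<le> \<bar>coord l w\<bar>" using cl by linarith
    then have one: "1 \<le> M * norm w" using M(2)[OF l(1), of w] by linarith
    have "(2 * M * norm w) powr s \<le> (1 + \<bar>real_of_int \<lfloor>coord j w\<rfloor>\<bar>) powr s" if j: "j \<in> {1..N}" for j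
      using M(2)[OF j, of w] coord_lattice[of w j] w j one s by (intro powr_mono2') auto
    then have le: "(\<Prod>j=1..N. (2 * M * norm w) powr s) \<le> (\<Prod>j=1..N. (1 + \<bar>real_of_int \<lfloor>coord j w\<rfloor>\<bar>) powr s)"
      by (intro prod_mono) auto
    have eq: "(\<Prod>j=1..N. (2 * M * norm w) powr s) = inverse ((2 * M) ^ Suc N * norm w ^ Suc N)"
    proof -
      have y: "0 < 2 * M * norm w" using M(1) wpos by simp
      have "(\<Prod>j=1..N. (2 * M * norm w) powr s) = ((2 * M * norm w) powr s) powr real N"
        using y by (subst powr_realpow) (simp_all only: powr_gt_zero prod_constant card_atLeastAtMost diff_Suc_1 Suc_eq_plus1 add_diff_cancel, auto)
      also have "\<dots> = (2 * M * norm w) powr (s * real N)" by (rule powr_powr)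
      also have "s * real N = - real (Suc N)" using assms by (simp add: s_def field_simps)
      also have "(2 * M * norm w) powr (- real (Suc N)) = inverse ((2 * M * norm w) ^ Suc N)"
        using y by (simp only: powr_minus powr_realpow)
      finally show ?thesis by (simp add: power_mult_distrib)
    qed
    have A: "(2 * M) ^ Suc N > 0" using M(1) by (intro zero_less_power) simp
    then have "inverse (norm w ^ Suc N) = (2 * M) ^ Suc N * inverse ((2 * M) ^ Suc N * norm w ^ Suc N)"
      by (simp only: inverse_mult_distrib mult.assoc[symmetric] right_inverse less_imp_neq[symmetric]
          not_False_eq_True mult_1)
    also have "\<dots> \<le> (2 * M) ^ Suc N * (\<Prod>j=1..N. (1 + \<bar>real_of_int \<lfloor>coord j w\<rfloor>\<bar>) powr s)"
      using le eq A by (intro mult_left_mono) simp_all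
    also have "\<dots> = (2 * M) ^ Suc N * ?h (?c w)"
      by (intro arg_cong2[of _ _ _ _ "(*)"] refl prod.cong) simp
    finally show "inverse (norm w ^ Suc N) \<le> (2 * M) ^ Suc N * ?h (?c w)" .
  qed auto
qed

lemma lattice_add_multiple:
  assumes "w \<in> lattice" "j \<in> {1..N}"
  shows "w + of_int n *\<^sub>R v j \<in> lattice"
proof -
  obtain k where w: "w = (\<Sum>l=1..N. real_of_int (k l) *\<^sub>R v l)"
    using assms by (auto simp: int_lattice_def)
  have "(\<Sum>l=1..N. if l = j then of_int n *\<^sub>R v l else 0) = of_int n *\<^sub>R v j"
    using assms(2) by (simp only: sum.delta finite_atLeastAtMost if_True)
  then have "w + of_int n *\<^sub>R v j
      = (\<Sum>l=1..N. real_of_int (k l) *\<^sub>R v l + (if l = j then of_int n *\<^sub>R v l else 0))"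
    by (simp only: w sum.distrib)
  also have "\<dots> = (\<Sum>l=1..N. real_of_int (if l = j then k l + n else k l) *\<^sub>R v l)"
    by (intro sum.cong) (auto simp: scaleR_add_left)
  finally show ?thesis
    unfolding int_lattice_def mem_Collect_eq by (intro exI[of _ "\<lambda>l. if l = j then k l + n else k l"]) simp
qed

text \<open>The lattice is the disjoint union of the lines in direction \<open>v j\<close>; a line is indexed by
  its point with vanishing \<open>j\<close>-th coordinate. Unconditional convergence allows summing line
  by line, and along each line the sum telescopes to \<open>0\<close>.\<close>

lemma lattice_telescope:
  fixes G :: "'a \<Rightarrow> 'b::banach"
  assumes j: "j \<in> {1..N}"
    and sum: "((\<lambda>w. G (w - v j) - G w) has_sum s) lattice"
    and top: "\<And>w. w \<in> lattice \<Longrightarrow> ((\<lambda>n. G (w + of_int n *\<^sub>R v j)) \<longlongrightarrow> 0) at_top"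
    and bot: "\<And>w. w \<in> lattice \<Longrightarrow> ((\<lambda>n. G (w + of_int n *\<^sub>R v j)) \<longlongrightarrow> 0) at_bot"
  shows "s = 0"
proof -
  define T where "T = {w \<in> lattice. coord j w = 0}"
  define p where "p = (\<lambda>(w, n). w + real_of_int n *\<^sub>R v j)"
  have coord_p: "coord j (p (w, n)) = coord j w + of_int n" for w n
    using linear_coord[OF j] coord_basis[OF j j] by (simp add: p_def linear_add linear_cmul)
  have p_lattice: "p (w, n) \<in> lattice" if "w \<in> lattice" for w n
    unfolding p_def using lattice_add_multiple[OF that j] by simp
  have inj: "inj_on p (T \<times> UNIV)"
  proof (rule inj_onI, clarify)
    fix w n w' n' assume T: "w \<in> T" "w' \<in> T" and eq: "p (w, n) = p (w', n')"
    have "n = n'"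
      using arg_cong[OF eq, of "coord j"] T unfolding coord_p by (simp add: T_def)
    then show "w = w' \<and> n = n'" using eq by (simp add: p_def)
  qed
  have "p ` (T \<times> UNIV) = lattice"
  proof
    show "p ` (T \<times> UNIV) \<subseteq> lattice" using p_lattice by (auto simp: T_def)
    show "lattice \<subseteq> p ` (T \<times> UNIV)"
    proof
      fix w assume w: "w \<in> lattice"
      have "coord j (p (w, - \<lfloor>coord j w\<rfloor>)) = 0"
        unfolding coord_p using coord_lattice[OF w j] by simp
      then have "p (w, - \<lfloor>coord j w\<rfloor>) \<in> T"
        using p_lattice[OF w] by (simp add: T_def)
      moreover have "w = p (p (w, - \<lfloor>coord j w\<rfloor>), \<lfloor>coord j w\<rfloor>)" by (simp add: p_def)
      ultimately show "w \<in> p ` (T \<times> UNIV)" by blast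
    qed
  qed
  with inj have bij: "bij_betw p (T \<times> UNIV) lattice" by (simp add: bij_betw_def)
  define F where "F = (\<lambda>w. G (w - v j) - G w)"
  have sum': "((\<lambda>x. F (p x)) has_sum s) (T \<times> UNIV)"
    using sum unfolding F_def[symmetric] by (subst has_sum_reindex_bij_betw[OF bij])
  have "((\<lambda>n. F (p (w, n))) has_sum 0) UNIV" if w: "w \<in> T" for w
  proof -
    have "(\<lambda>x. F (p x)) summable_on (Pair w ` UNIV)"
    proof (rule summable_on_subset_banach)
      show "(\<lambda>x. F (p x)) summable_on (T \<times> UNIV)" using sum' unfolding has_sum_iff by blast
      show "Pair w ` UNIV \<subseteq> T \<times> UNIV" using w by blast
    qed
    then have "(\<lambda>n. F (p (w, n))) summable_on UNIV"
      by (subst (asm) summable_on_reindex) (simp_all add: o_def inj_on_def)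
    then obtain t where t: "((\<lambda>n. F (p (w, n))) has_sum t) UNIV"
      by (auto simp: summable_on_def)
    moreover have "F (p (w, n)) = G (w + of_int (n - 1) *\<^sub>R v j) - G (w + of_int n *\<^sub>R v j)" for n
      by (simp add: F_def p_def algebra_simps)
    ultimately have "((\<lambda>n. G (w + of_int (n - 1) *\<^sub>R v j) - G (w + of_int n *\<^sub>R v j)) has_sum t) UNIV"
      by simp
    then have "t = 0"
      by (rule has_sum_int_telescope) (use w top bot in \<open>auto simp: T_def\<close>)
    with t show ?thesis by simp
  qed
  then have "((\<lambda>_. 0) has_sum s) T"
    by (rule has_sum_SigmaD[OF sum'])
  then show ?thesis
    using has_sum_unique[OF _ has_sum_0[of T "\<lambda>_. 0"]] by blast
qed

end

lemma dual_functionals: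
  fixes v :: "nat \<Rightarrow> 'a::euclidean_space"
  assumes "inj_on v {1..N}" "independent (v ` {1..N})"
  shows "\<exists>coord. based_lattice N v coord"
proof -
  have "\<exists>f. linear f \<and> (\<forall>l\<in>{1..N}. f (v l) = (if l = j then 1 else 0::real))" if "j \<in> {1..N}" for j
  proof -
    obtain f :: "'a \<Rightarrow> real" where f: "linear f" "\<forall>x\<in>v ` {1..N}. f x = (if x = v j then 1 else 0)"
      using linear_independent_extend[OF assms(2), of "\<lambda>x. if x = v j then 1 else 0"] by auto
    then show ?thesis using assms(1) that by (intro exI[of _ f]) (simp add: inj_on_eq_iff)
  qed
  then have "\<forall>j\<in>{1..N}. \<exists>f. linear f \<and> (\<forall>l\<in>{1..N}. f (v l) = (if l = j then 1 else 0::real))"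
    by blast
  from bchoice[OF this] obtain c
    where "\<forall>j\<in>{1..N}. linear (c j) \<and> (\<forall>l\<in>{1..N}. c j (v l) = (if l = j then 1 else 0::real))" ..
  then show ?thesis unfolding based_lattice_def by blast
qed

section \<open>Paravectors\<close>

lemma scalar_plus_gens_paravector: "x0 *\<^sub>R 1 + (\<Sum>i\<in>UNIV. x i *\<^sub>R gen i) \<in> paravectors"
  unfolding paravectors_def by blast

lemma subspace_paravectors: "subspace (paravectors :: 'n::{finite,linorder} clifford set)"
proof (rule subspaceI)
  show "(0 :: 'n clifford) \<in> paravectors"
    using scalar_plus_gens_paravector[of 0 "\<lambda>_. 0"] by simp
next
  fix x y :: "'n clifford" assume "x \<in> paravectors" "y \<in> paravectors"
  then obtain x0 xs y0 ys where "x = x0 *\<^sub>R 1 + (\<Sum>i\<in>UNIV. xs i *\<^sub>R gen i)"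
    "y = y0 *\<^sub>R 1 + (\<Sum>i\<in>UNIV. ys i *\<^sub>R gen i)"
    by (auto simp: paravectors_def)
  then have "x + y = (x0 + y0) *\<^sub>R 1 + (\<Sum>i\<in>UNIV. (xs i + ys i) *\<^sub>R gen i)"
    by (simp add: scaleR_add_left sum.distrib)
  then show "x + y \<in> paravectors" using scalar_plus_gens_paravector by metis
next
  fix c and x :: "'n clifford" assume "x \<in> paravectors"
  then obtain x0 xs where "x = x0 *\<^sub>R 1 + (\<Sum>i\<in>UNIV. xs i *\<^sub>R gen i)"
    by (auto simp: paravectors_def)
  then have "c *\<^sub>R x = (c * x0) *\<^sub>R 1 + (\<Sum>i\<in>UNIV. (c * xs i) *\<^sub>R gen i)"
    by (simp add: scaleR_add_right scaleR_sum_right)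
  then show "c *\<^sub>R x \<in> paravectors" using scalar_plus_gens_paravector by metis
qed

lemma inner_blade_blade: "inner (blade A) (blade B) = (if A = B then 1 else 0)"
  by (simp add: inner_clifford_def blade.rep_eq if_distrib[of "\<lambda>t. t * _"] cong: if_cong)

lemma norm_paravector:
  "(norm (x0 *\<^sub>R 1 + (\<Sum>i\<in>UNIV. x i *\<^sub>R gen i)))\<^sup>2 = x0\<^sup>2 + (\<Sum>i\<in>UNIV. (x i)\<^sup>2)"
proof -
  have "inner (\<Sum>i\<in>UNIV. x i *\<^sub>R gen i) (\<Sum>i\<in>UNIV. x i *\<^sub>R gen i) = (\<Sum>i\<in>UNIV. (x i)\<^sup>2)"
    by (simp add: inner_sum_left inner_sum_right gen_def inner_blade_blade power2_eq_square
        if_distrib[of "\<lambda>t. _ * t"] cong: if_cong)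
  moreover have "inner 1 (\<Sum>i\<in>UNIV. x i *\<^sub>R gen i) = 0"
    unfolding blade_empty[symmetric] by (simp add: inner_sum_right gen_def inner_blade_blade)
  moreover have "inner (1 :: 'a clifford) 1 = 1"
    unfolding blade_empty[symmetric] by (simp add: inner_blade_blade)
  ultimately show ?thesis
    unfolding power2_norm_eq_inner by (simp add: inner_add_left inner_add_right inner_commute power2_eq_square)
qed

text \<open>The inverse is the conjugate paravector, of the same norm, divided by the squared norm.\<close>

lemma norm_ring_inverse:
  assumes "x \<in> paravectors" "x \<noteq> 0"
  shows "norm (ring_inverse x) = inverse (norm x)"
proof -
  obtain x0 xs where x: "x = x0 *\<^sub>R 1 + (\<Sum>i\<in>UNIV. xs i *\<^sub>R gen i)"
    using assms(1) by (auto simp: paravectors_def)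
  define y where "y = x0 *\<^sub>R 1 + (\<Sum>i\<in>UNIV. (- xs i) *\<^sub>R gen i)"
  have y: "y = x0 *\<^sub>R 1 - (\<Sum>i\<in>UNIV. xs i *\<^sub>R gen i)"
    by (simp add: y_def sum_negf)
  have norms: "(norm x)\<^sup>2 = x0\<^sup>2 + (\<Sum>i\<in>UNIV. (xs i)\<^sup>2)" "(norm y)\<^sup>2 = x0\<^sup>2 + (\<Sum>i\<in>UNIV. (xs i)\<^sup>2)"
    unfolding x y_def norm_paravector by simp_all
  then have norm_y: "norm y = norm x" by (metis norm_ge_zero power2_eq_imp_eq)
  have prod: "x * y = (norm x)\<^sup>2 *\<^sub>R 1" "y * x = (norm x)\<^sup>2 *\<^sub>R 1"
    unfolding norms unfolding x y
    by (simp_all add: distrib_left distrib_right left_diff_distrib right_diff_distrib gen_sum_square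
        scaleR_add_left scaleR_add_right scaleR_diff_right power2_eq_square)
  have "ring_inverse x = inverse ((norm x)\<^sup>2) *\<^sub>R y"
    using assms(2) by (intro ring_inverse_eqI) (simp_all add: prod)
  then show ?thesis
    using assms(2) by (simp add: norm_y power2_eq_square)
qed

text \<open>The Euclidean norm is in general not submultiplicative on the whole algebra, but multiplication is
  bilinear on a finite-dimensional space and hence bounded.\<close>

lemma clifford_norm_mult_le:
  obtains K where "K > 0" "\<And>a b :: 'n::{finite,linorder} clifford. norm (a * b) \<le> K * norm a * norm b"
proof -
  have "bounded_bilinear (\<lambda>a b :: 'n clifford. a * b)"
    using bilinear_times bilinear_conv_bounded_bilinear by blast
  then obtain K where "K > 0" "\<forall>a b :: 'n clifford. norm (a * b) \<le> norm a * norm b * K"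
    using bounded_bilinear.pos_bounded by blast
  then show thesis by (intro that[of K]) (simp_all add: mult_ac)
qed

text \<open>This is the finite geometric sum in \<open>u = ring_inverse w * x\<close>, because
  \<open>ring_inverse w * (x - w) = u - 1\<close>.
  The remainder gains the factor \<open>norm w ^ -(N + 1)\<close> that makes the zeta series converge.\<close>

lemma kernel_remainder:
  fixes x w :: "'n::{finite,linorder} clifford"
  assumes "w \<in> paravectors" "w \<noteq> 0" "x - w \<in> paravectors" "x \<noteq> w"
  shows "ring_inverse (x - w) + (\<Sum>\<mu><N. (ring_inverse w * x) ^ \<mu> * ring_inverse w)
    = (ring_inverse w * x) ^ N * ring_inverse (x - w)"
proof -
  define u where "u = ring_inverse w * x"
  have w: "ring_inverse w * (x - w) = u - 1"
    using paravector_invertible[OF assms(1,2)] by (simp add: u_def right_diff_distrib)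
  have inv: "(x - w) * ring_inverse (x - w) = 1"
    using paravector_invertible[OF assms(3)] assms(4) by simp
  have "(\<Sum>\<mu><N. u ^ \<mu> * ring_inverse w) * (x - w) = (\<Sum>\<mu><N. u ^ \<mu> * (u - 1))"
    by (simp add: sum_distrib_right mult.assoc w)
  also have "\<dots> = u ^ N - 1"
    by (induction N) (simp_all add: right_diff_distrib power_commutes)
  finally have "(\<Sum>\<mu><N. u ^ \<mu> * ring_inverse w) * (x - w) * ring_inverse (x - w)
      = (u ^ N - 1) * ring_inverse (x - w)" by simp
  then have "(\<Sum>\<mu><N. u ^ \<mu> * ring_inverse w) = (u ^ N - 1) * ring_inverse (x - w)"
    by (simp only: mult.assoc inv mult_1_right)
  then show ?thesis
    by (simp add: left_diff_distrib u_def[symmetric])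
qed

section \<open>Iterated differences\<close>

abbreviation nabla :: "'a::plus list \<Rightarrow> ('a \<Rightarrow> 'b::minus) \<Rightarrow> 'a \<Rightarrow> 'b" where
  "nabla \<equiv> foldr id_minus_translate"

lemma foldr_comp_id_minus_translate:
  "foldr (\<circ>) (map (\<lambda>j. id_minus_translate (v j)) js) id f = nabla (map v js) f"
  by (induction js) auto

lemma nabla_Cons: "nabla (a # as) f x = nabla as f x - nabla as f (x + a)"
  by (simp add: id_minus_translate_def translate_def)

lemma nabla_add:
  fixes f g :: "'a::plus \<Rightarrow> 'b::ab_group_add"
  shows "nabla as (\<lambda>x. f x + g x) = (\<lambda>x. nabla as f x + nabla as g x)"
  by (induction as) (auto simp: id_minus_translate_def translate_def)

lemma nabla_shift:
  fixes f :: "'a::ab_group_add \<Rightarrow> 'b::ab_group_add"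
  shows "nabla as (\<lambda>x. f (x - w)) = (\<lambda>x. nabla as f (x - w))"
  by (induction as) (auto simp: id_minus_translate_def translate_def algebra_simps)

text \<open>An iterated difference is a finite combination of translates, so it may be applied term by term.\<close>

lemma has_sum_nabla:
  fixes t :: "'w \<Rightarrow> 'a::plus \<Rightarrow> 'b::{topological_ab_group_add}"
  assumes "\<And>x. x \<in> D \<Longrightarrow> ((\<lambda>w. t w x) has_sum f x) L"
    and "\<And>x a. x \<in> D \<Longrightarrow> a \<in> set as \<Longrightarrow> x + a \<in> D" and "x \<in> D"
  shows "((\<lambda>w. nabla as (t w) x) has_sum nabla as f x) L"
  using assms(2,3)
proof (induction as arbitrary: x)
  case Nil
  then show ?case using assms(1) by simp
next
  case (Cons a as)
  have "((\<lambda>w. nabla as (t w) x + - nabla as (t w) (x + a)) has_sum nabla as f x + - nabla as f (x + a)) L"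
    using Cons by (intro has_sum_add) (simp_all add: has_sum_uminus)
  then show ?case by (simp only: nabla_Cons diff_conv_add_uminus)
qed

lemma nabla_tendsto_0:
  fixes f :: "'a::ab_semigroup_add \<Rightarrow> 'b::real_normed_vector"
  assumes "\<And>x. x \<in> D \<Longrightarrow> ((\<lambda>n. f (x + p n)) \<longlongrightarrow> 0) F"
    and "\<And>x a. x \<in> D \<Longrightarrow> a \<in> set as \<Longrightarrow> x + a \<in> D" and "x \<in> D"
  shows "((\<lambda>n. nabla as f (x + p n)) \<longlongrightarrow> 0) F"
  using assms(2,3)
proof (induction as arbitrary: x)
  case Nil
  then show ?case using assms(1) by simp
next
  case (Cons a as)
  have "((\<lambda>n. nabla as f (x + p n) - nabla as f ((x + a) + p n)) \<longlongrightarrow> 0 - 0) F"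
    using Cons by (intro tendsto_diff) simp_all
  moreover have "x + a + p n = x + p n + a" for n by (simp add: add_ac)
  ultimately show ?case by (simp only: nabla_Cons diff_0_right)
qed

text \<open>Generalized polynomials of degree at most \<open>d\<close> in the sense of Frechet: functions whose
  differences of order \<open>d + 1\<close> all vanish. This avoids coefficients, which are awkward here because words such as
  \<open>c * x * c * x\<close> do not commute.\<close>

primrec poly_deg :: "nat \<Rightarrow> ('a::ab_group_add \<Rightarrow> 'b::ab_group_add) \<Rightarrow> bool" where
  "poly_deg 0 f \<longleftrightarrow> (\<forall>x y. f x = f y)"
| "poly_deg (Suc d) f \<longleftrightarrow> (\<forall>a. poly_deg d (id_minus_translate a f))"

lemma poly_deg_add:
  assumes "poly_deg d f" "poly_deg d g"
  shows "poly_deg d (\<lambda>x. f x + g x)"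
  using assms
proof (induction d arbitrary: f g)
  case 0
  then show ?case by simp metis
next
  case (Suc d)
  have "id_minus_translate a (\<lambda>x. f x + g x)
      = (\<lambda>x. id_minus_translate a f x + id_minus_translate a g x)" for a
    by (auto simp: id_minus_translate_def translate_def)
  then show ?case using Suc by simp
qed

lemma poly_deg_translate:
  assumes "poly_deg d f"
  shows "poly_deg d (translate b f)"
  using assms
proof (induction d arbitrary: f)
  case 0
  then show ?case by (simp add: translate_def)
next
  case (Suc d)
  have "id_minus_translate a (translate b f) = translate b (id_minus_translate a f)" for a
    by (auto simp: id_minus_translate_def translate_def add_ac)
  then show ?case using Suc by simp
qed

lemma poly_deg_Suc:
  assumes "poly_deg d f"
  shows "poly_deg (Suc d) f"
  using assms
proof (induction d arbitrary: f)
  case 0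
  then have "id_minus_translate a f = (\<lambda>_. 0)" for a
    unfolding id_minus_translate_def translate_def by (metis poly_deg.simps(1) diff_self)
  then show ?case by simp
qed simp

lemma poly_deg_mono:
  assumes "poly_deg d f" "d \<le> e"
  shows "poly_deg e f"
  using assms(2,1) by (induction e rule: dec_induct) (auto simp del: poly_deg.simps intro: poly_deg_Suc)

lemma poly_deg_mult_const:
  fixes f :: "'a::ab_group_add \<Rightarrow> 'b::ring"
  assumes "poly_deg d f"
  shows "poly_deg d (\<lambda>x. c * f x)"
  using assms
proof (induction d arbitrary: f)
  case 0
  then show ?case by simp metis
next
  case (Suc d)
  have "id_minus_translate a (\<lambda>x. c * f x) = (\<lambda>x. c * id_minus_translate a f x)" for a
    by (auto simp: id_minus_translate_def translate_def right_diff_distrib)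
  then show ?case using Suc by simp
qed

text \<open>Product rule for differences: \<open>id_minus_translate a\<close> hits either \<open>f\<close>, leaving \<open>c * x\<close>
  times a polynomial of lower degree, or \<open>c * x\<close>, leaving a constant times a translate of \<open>f\<close>.\<close>

lemma poly_deg_mult_linear:
  fixes f :: "'a::ring \<Rightarrow> 'a"
  assumes "poly_deg d f"
  shows "poly_deg (Suc d) (\<lambda>x. c * x * f x)"
  using assms
proof (induction d arbitrary: f)
  case 0
  then obtain b where "f = (\<lambda>_. b)" by (metis poly_deg.simps(1) ext)
  then show ?case
    by (simp add: id_minus_translate_def translate_def algebra_simps)
next
  case (Suc d)
  have "id_minus_translate a (\<lambda>x. c * x * f x)
      = (\<lambda>x. c * x * id_minus_translate a f x + - (c * a) * translate a f x)" for a
    by (auto simp: id_minus_translate_def translate_def algebra_simps)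
  moreover have "poly_deg (Suc d) (\<lambda>x. c * x * id_minus_translate a f x + - (c * a) * translate a f x)" for a
    using Suc by (intro poly_deg_add poly_deg_mult_const poly_deg_translate Suc.IH) auto
  ultimately show ?case by (simp only: poly_deg.simps(2)[of "Suc d"]) simp
qed

lemma poly_deg_monomial:
  fixes c b :: "'a::ring_1"
  shows "poly_deg d (\<lambda>x. (c * x) ^ d * b)"
proof (induction d)
  case (Suc d)
  then have "poly_deg (Suc d) (\<lambda>x. c * x * ((c * x) ^ d * b))"
    by (rule poly_deg_mult_linear)
  then show ?case by (simp only: power_Suc mult.assoc)
qed simp

lemma poly_deg_sum:
  fixes n :: nat
  assumes "\<And>\<mu>. \<mu> < n \<Longrightarrow> poly_deg d (f \<mu>)"
  shows "poly_deg d (\<lambda>x. \<Sum>\<mu><n. f \<mu> x)"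
  using assms
proof (induction n)
  case 0
  have "poly_deg 0 (\<lambda>x::'a. 0::'b)" by simp
  then have "poly_deg d (\<lambda>x::'a. 0::'b)" by (rule poly_deg_mono) simp
  then show ?case by simp
next
  case (Suc n)
  then show ?case by (simp add: poly_deg_add)
qed

lemma poly_deg_nabla:
  assumes "poly_deg (length as + d) f"
  shows "poly_deg d (nabla as f)"
  using assms
proof (induction as arbitrary: d)
  case (Cons a as)
  then have "poly_deg (Suc d) (nabla as f)" by (intro Cons.IH) simp
  then show ?case by simp
qed simp

section \<open>The zeta series\<close>

text \<open>The convergence-producing part of the zeta term for \<open>w\<close>. It is \<open>0\<close> for \<open>w = 0\<close>, so that
  all terms have the form \<open>ring_inverse (x - w) + correction N w x\<close>.\<close>

definition correction :: "nat \<Rightarrow> 'n::{finite,linorder} clifford \<Rightarrow> 'n clifford \<Rightarrow> 'n clifford" where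
  "correction N w x =
     (if w = 0 then 0 else \<Sum>\<mu><N. (ring_inverse w * x) ^ \<mu> * ring_inverse w)"

lemma poly_deg_correction: "poly_deg (N - 1) (correction N w)"
proof -
  have "poly_deg (N - 1) (\<lambda>x. \<Sum>\<mu><N. (ring_inverse w * x) ^ \<mu> * ring_inverse w)"
    by (intro poly_deg_sum poly_deg_mono[OF poly_deg_monomial]) simp
  moreover have "poly_deg (N - 1) (\<lambda>x::'a clifford. 0 :: 'a clifford)"
    by (rule poly_deg_mono[of 0]) simp_all
  ultimately show ?thesis
    by (cases "w = 0") (simp_all add: correction_def[abs_def])
qed

lemma clifford_power_mult_le:
  fixes u b :: "'n::{finite,linorder} clifford"
  assumes "K > 0" "\<And>a b :: 'n clifford. norm (a * b) \<le> K * norm a * norm b"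
  shows "norm (u ^ n * b) \<le> (K * norm u) ^ n * norm b"
proof (induction n)
  case (Suc n)
  have "norm (u ^ Suc n * b) \<le> K * norm u * norm (u ^ n * b)"
    using assms(2)[of u "u ^ n * b"] by (simp add: mult.assoc)
  also have "\<dots> \<le> K * norm u * ((K * norm u) ^ n * norm b)"
    using Suc assms(1) by (intro mult_left_mono) auto
  finally show ?case by (simp add: mult_ac)
qed simp

text \<open>The finitely many \<open>w\<close> with \<open>norm w \<le> 2 * norm x\<close> are split off. For the others
  \<open>norm (x - w) \<ge> norm w / 2\<close>, and the remainder formula bounds the term by a multiple of
  \<open>norm w ^ -(N + 1)\<close>, with a constant depending on \<open>x\<close>.\<close>

lemma summable_on_zeta_terms:
  fixes v :: "nat \<Rightarrow> 'n::{finite,linorder} clifford"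
  assumes "based_lattice N v coord" "N \<ge> 1" "int_lattice N v \<subseteq> paravectors" "x \<in> paravectors"
  shows "(\<lambda>w. ring_inverse (x - w) + correction N w x) summable_on int_lattice N v"
proof -
  interpret based_lattice N v coord by fact
  let ?t = "\<lambda>w. ring_inverse (x - w) + correction N w x"
  let ?B = "{w \<in> lattice. norm w \<le> 2 * norm x}"
  obtain K where K: "K > 0" "\<And>a b :: 'n clifford. norm (a * b) \<le> K * norm a * norm b"
    using clifford_norm_mult_le by blast
  define C where "C = (K * (K * norm x)) ^ N * 2"
  have bound: "norm (?t w) \<le> norm (C * inverse (norm w ^ Suc N))" if w: "w \<in> lattice - ?B" for w
  proof -
    have large: "2 * norm x < norm w" using w by auto
    have nz: "w \<noteq> 0"
    proof
      assume "w = 0"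
      with large show False using norm_ge_zero[of x] by simp
    qed
    have neq: "x \<noteq> w"
    proof
      assume "x = w"
      with large show False using norm_ge_zero[of x] by simp
    qed
    have pv: "w \<in> paravectors" "x - w \<in> paravectors"
      using w assms(3,4) subspace_diff[OF subspace_paravectors] by auto
    have half: "norm w / 2 \<le> norm (x - w)"
      using norm_triangle_ineq2[of w x] large by (simp add: norm_minus_commute)
    have inv: "norm (ring_inverse (x - w)) \<le> 2 * inverse (norm w)"
    proof -
      have "inverse (norm (x - w)) \<le> inverse (norm w / 2)"
        using half nz by (intro le_imp_inverse_le) auto
      then show ?thesis using neq by (subst norm_ring_inverse[OF pv(2)]) (simp_all add: inverse_eq_divide)
    qed
    have u: "norm (ring_inverse w * x) \<le> K * inverse (norm w) * norm x"
      using K(2)[of "ring_inverse w" x] norm_ring_inverse[OF pv(1) nz] by simp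
    have "norm (?t w) = norm ((ring_inverse w * x) ^ N * ring_inverse (x - w))"
      using kernel_remainder[OF pv(1) nz pv(2) neq, of N] nz by (simp add: correction_def)
    also have "\<dots> \<le> (K * norm (ring_inverse w * x)) ^ N * norm (ring_inverse (x - w))"
      using K by (rule clifford_power_mult_le)
    also have "\<dots> \<le> (K * (K * inverse (norm w) * norm x)) ^ N * (2 * inverse (norm w))"
      using u inv K(1) by (intro mult_mono power_mono mult_left_mono) auto
    also have "\<dots> = C * inverse (norm w ^ Suc N)"
      by (simp add: C_def power_mult_distrib power_inverse)
    finally show ?thesis using K(1) by (simp add: C_def)
  qed
  have "(\<lambda>w. inverse (norm w ^ Suc N)) summable_on (lattice - ?B)"
    by (rule summable_on_subset_banach[OF summable_on_lattice_norm[OF assms(2)]]) auto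
  then have "(\<lambda>w. C * inverse (norm w ^ Suc N)) summable_on (lattice - ?B)"
    by (rule summable_on_cmult_right)
  then have "(\<lambda>w. norm (C * inverse (norm w ^ Suc N))) summable_on (lattice - ?B)"
    by (rule summable_on_iff_abs_summable_on_real[THEN iffD1])
  then have "(\<lambda>w. norm (?t w)) summable_on (lattice - ?B)"
    using bound by (rule Infinite_Sum.abs_summable_on_comparison_test)
  then have "?t summable_on (lattice - ?B)" by (rule abs_summable_summable)
  moreover have "?t summable_on ?B"
    using finite_lattice_ball by (rule summable_on_finite)
  ultimately have "?t summable_on ((lattice - ?B) \<union> ?B)" by (rule summable_on_Un_disjoint) blast
  moreover have "(lattice - ?B) \<union> ?B = lattice" by auto
  ultimately show ?thesis by simp
qed

text \<open>Unconditional convergence makes the value independent of the enumeration \<open>w\<close>. At a lattice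
  point \<open>x\<close> one term is the unspecified value \<open>ring_inverse 0\<close>, the same one on both sides.\<close>

lemma zeta_has_sum:
  fixes v :: "nat \<Rightarrow> 'n::{finite,linorder} clifford"
  assumes "based_lattice N v coord" "N \<ge> 1" "int_lattice N v \<subseteq> paravectors" "x \<in> paravectors"
    and w: "bij_betw w UNIV (int_lattice N v)" "w 0 = 0"
  shows "((\<lambda>u. ring_inverse (x - u) + correction N u x) has_sum zeta N w x) (int_lattice N v)"
proof -
  let ?t = "\<lambda>u. ring_inverse (x - u) + correction N u x"
  obtain s where s: "(?t has_sum s) (int_lattice N v)"
    using summable_on_zeta_terms[OF assms(1-4)] by (auto simp: summable_on_def)
  then have "((\<lambda>p. ?t (w p)) has_sum s) UNIV"
    using has_sum_reindex_bij_betw[OF w(1), of ?t s] by blast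
  then have "(\<lambda>p. ?t (w p)) sums s" by (rule has_sum_imp_sums)
  then have "(\<lambda>p. ?t (w (Suc p))) sums (s - ?t (w 0))"
    by (subst sums_Suc_iff) simp
  moreover have "w (Suc p) \<noteq> 0" for p
    using w by (metis bij_betw_imp_inj_on inj_eq nat.distinct(1))
  ultimately have "s = zeta N w x"
    using w(2) by (simp add: zeta_def correction_def sums_iff)
  with s show ?thesis by simp
qed

section \<open>Periods of the differenced zeta function\<close>

lemma ring_inverse_tendsto_0:
  fixes a y :: "'n::{finite,linorder} clifford"
  assumes "a \<in> paravectors" "a \<noteq> 0" "y \<in> paravectors"
    and F: "filterlim (\<lambda>n. \<bar>real_of_int n\<bar>) at_top F"
  shows "((\<lambda>n. ring_inverse (y + of_int n *\<^sub>R a)) \<longlongrightarrow> 0) F"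
proof -
  have pv: "y + of_int n *\<^sub>R a \<in> paravectors" for n
    using assms subspace_paravectors by (intro subspace_add subspace_scale) auto
  have "filterlim (\<lambda>n. - norm y + \<bar>real_of_int n\<bar> * norm a) at_top F"
    using assms by (intro filterlim_tendsto_add_at_top[OF tendsto_const] filterlim_at_top_mult_tendsto_pos[OF tendsto_const]) auto
  then have lim: "filterlim (\<lambda>n. norm (y + of_int n *\<^sub>R a)) at_top F"
  proof (rule filterlim_at_top_mono, intro always_eventually allI)
    fix n
    show "- norm y + \<bar>real_of_int n\<bar> * norm a \<le> norm (y + of_int n *\<^sub>R a)"
      using norm_triangle_ineq2[of "of_int n *\<^sub>R a" "- y"] by (simp add: add.commute)
  qed
  have "((\<lambda>n. inverse (norm (y + of_int n *\<^sub>R a))) \<longlongrightarrow> 0) F"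
    using tendsto_inverse_0_at_top[OF lim] .
  moreover have "\<forall>\<^sub>F n in F. norm (ring_inverse (y + of_int n *\<^sub>R a)) = inverse (norm (y + of_int n *\<^sub>R a))"
  proof -
    \<comment> \<open>The line passes through 0 at most once, so eventually the norm formula for inverses applies.\<close>
    have "\<forall>\<^sub>F n in F. norm (y + of_int n *\<^sub>R a) > 0"
      using lim unfolding filterlim_at_top_dense by blast
    then show ?thesis
      by eventually_elim (use norm_ring_inverse[OF pv] in auto)
  qed
  ultimately have "((\<lambda>n. norm (ring_inverse (y + of_int n *\<^sub>R a))) \<longlongrightarrow> 0) F"
    by (subst tendsto_cong)
  then show ?thesis by (rule tendsto_norm_zero_cancel)
qed

text \<open>After \<open>N - 1\<close> differences the corrections, of degree at most \<open>N - 1\<close>, are constants \<open>c u\<close>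
  that do not depend on \<open>x\<close>. They cancel between \<open>x + v j\<close> and \<open>x\<close>, and what remains is the
  telescoping sum of the differenced kernel \<open>g\<close>, which tends to \<open>0\<close> along every lattice line.\<close>

lemma zeta_difference_periodic:
  fixes v :: "nat \<Rightarrow> 'n::{finite,linorder} clifford"
  assumes basis: "based_lattice N v coord" and N: "N \<ge> 1"
    and v: "\<And>j. j \<in> {1..N} \<Longrightarrow> v j \<in> paravectors"
    and w: "bij_betw w UNIV (int_lattice N v)" "w 0 = 0"
    and as: "length as = N - 1" "set as \<subseteq> paravectors"
    and x: "x \<in> paravectors" and j: "j \<in> {1..N}"
  shows "nabla as (zeta N w) (x + v j) = nabla as (zeta N w) x"
proof -
  interpret based_lattice N v coord by fact
  have pv_add: "y + z \<in> paravectors" if "y \<in> paravectors" "z \<in> paravectors" for y z :: "'n clifford"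
    using that subspace_paravectors by (rule_tac subspace_add)
  have lattice_pv: "lattice \<subseteq> paravectors"
    using v unfolding int_lattice_def
    by (auto intro!: subspace_sum subspace_scale subspace_paravectors)
  define g where "g = nabla as (ring_inverse :: 'n clifford \<Rightarrow> 'n clifford)"
  define c where "c u = nabla as (correction N u) 0" for u :: "'n clifford"
  have const: "nabla as (correction N u) y = c u" for u y
  proof -
    have "poly_deg 0 (nabla as (correction N u))"
      using as(1) poly_deg_correction[of N u] by (intro poly_deg_nabla) simp
    then show ?thesis unfolding c_def by simp
  qed
  have sum: "((\<lambda>u. g (y - u) + c u) has_sum nabla as (zeta N w) y) lattice" if y: "y \<in> paravectors" for y
  proof -
    have "((\<lambda>u. nabla as (\<lambda>x. ring_inverse (x - u) + correction N u x) y) has_sum nabla as (zeta N w) y) lattice"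
      using zeta_has_sum[OF basis N lattice_pv _ w] as(2) pv_add y
      by (intro has_sum_nabla[where D = paravectors]) auto
    then show ?thesis by (simp add: nabla_add nabla_shift const g_def)
  qed
  define G where "G u = g (x - u)" for u
  have "((\<lambda>u. (g (x + v j - u) + c u) + - (g (x - u) + c u)) has_sum
      nabla as (zeta N w) (x + v j) + - nabla as (zeta N w) x) lattice"
    using sum[OF x] sum[OF pv_add[OF x v[OF j]]] by (intro has_sum_add) (simp_all only: has_sum_uminus minus_minus)
  then have tele: "((\<lambda>u. G (u - v j) - G u) has_sum
      (nabla as (zeta N w) (x + v j) - nabla as (zeta N w) x)) lattice"
    by (simp add: G_def algebra_simps)
  have "v j \<noteq> 0"
    using coord_basis[OF j j] linear_0[OF linear_coord[OF j]] by auto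
  have lim: "((\<lambda>n. G (u + of_int n *\<^sub>R v j)) \<longlongrightarrow> 0) F"
    if u: "u \<in> lattice" and F: "filterlim (\<lambda>n. \<bar>real_of_int n\<bar>) at_top F" for u F
  proof -
    have "((\<lambda>n. g ((x - u) + of_int n *\<^sub>R (- v j))) \<longlongrightarrow> 0) F"
      unfolding g_def
    proof (rule nabla_tendsto_0[where D = paravectors])
      show "x - u \<in> paravectors" using x u lattice_pv subspace_diff[OF subspace_paravectors] by blast
      show "((\<lambda>n. ring_inverse (y + of_int n *\<^sub>R (- v j))) \<longlongrightarrow> 0) F" if "y \<in> paravectors" for y
        using that \<open>v j \<noteq> 0\<close> v[OF j] F by (intro ring_inverse_tendsto_0) (auto intro: subspace_neg subspace_paravectors)
      show "y + a \<in> paravectors" if "y \<in> paravectors" "a \<in> set as" for y a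
        using that as(2) pv_add by blast
    qed
    then show ?thesis by (simp add: G_def algebra_simps)
  qed
  have top: "filterlim (\<lambda>n. \<bar>real_of_int n\<bar>) at_top at_top"
    by (rule filterlim_compose[OF filterlim_abs_real filterlim_real_of_int_at_top])
  moreover have bot: "filterlim (\<lambda>n. \<bar>real_of_int n\<bar>) at_top at_bot"
    unfolding filterlim_at_top
  proof
    fix Z :: real
    show "\<forall>\<^sub>F n in at_bot. Z \<le> \<bar>real_of_int n\<bar>"
      using eventually_le_at_bot[of "- \<lceil>Z\<rceil>"] by eventually_elim linarith
  qed
  ultimately have "nabla as (zeta N w) (x + v j) - nabla as (zeta N w) x = 0"
    using lim by (intro lattice_telescope[OF j tele]) auto
  then show ?thesis by simp
qed

theorem mainTheorem1:
  fixes m :: nat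
    and \<omega> w :: "nat \<Rightarrow> 'n::{finite,linorder} clifford"
    and i :: nat
  assumes "CARD('n) = 2 * m + 1"
    and "\<And>j. j \<in> {1..2 * m + 2} \<Longrightarrow> \<omega> j \<in> paravectors"
    and "inj_on \<omega> {1..2 * m + 2}" and "independent (\<omega> ` {1..2 * m + 2})"
    and "bij_betw w UNIV (int_lattice (2 * m + 2) (\<lambda>j. 2 *\<^sub>R \<omega> j))" and "w 0 = 0"
    and "i \<in> {1..2 * m + 2}"
  shows "\<forall>x \<in> paravectors - int_lattice (2 * m + 2) \<omega>.
           S_fun (2 * m + 2) \<omega> w i (x + \<omega> i) = S_fun (2 * m + 2) \<omega> w i x \<and>
           (\<forall>k \<in> {1..2 * m + 2} - {i}. S_fun (2 * m + 2) \<omega> w i (x + 2 *\<^sub>R \<omega> k) = S_fun (2 * m + 2) \<omega> w i x)"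
proof -
  let ?N = "2 * m + 2"
  obtain coord where coord: "based_lattice ?N \<omega> coord"
    using dual_functionals assms(3,4) by blast
  have basis: "based_lattice ?N (\<lambda>j. 2 *\<^sub>R \<omega> j) (\<lambda>j x. coord j x / 2)"
  proof (rule based_lattice.intro)
    fix j assume "j \<in> {1..?N}"
    then have lin: "linear (coord j)" using coord by (auto simp: based_lattice_def)
    show "linear (\<lambda>x. coord j x / 2)"
      by (rule linearI) (simp_all add: linear_add[OF lin] linear_cmul[OF lin] add_divide_distrib)
  next
    fix j l assume "j \<in> {1..?N}" "l \<in> {1..?N}"
    moreover from this have lin: "linear (coord j)" using coord by (auto simp: based_lattice_def)
    ultimately show "coord j (2 *\<^sub>R \<omega> l) / 2 = (if l = j then 1 else 0)"
      using coord by (simp add: linear_cmul[OF lin] based_lattice_def)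
  qed
  define as where "as = map \<omega> (filter (\<lambda>j. j \<noteq> i) [1..<Suc ?N])"
  define Z where "Z = nabla as (zeta ?N w)"
  have as: "length as = ?N - 1" "set as \<subseteq> paravectors"
  proof -
    have "length as = card (set (filter (\<lambda>j. j \<noteq> i) [1..<Suc ?N]))"
      unfolding as_def by (subst distinct_card) auto
    also have "set (filter (\<lambda>j. j \<noteq> i) [1..<Suc ?N]) = {1..?N} - {i}" by auto
    finally show "length as = ?N - 1" using assms(7) by (simp add: card_Diff_singleton)
    show "set as \<subseteq> paravectors" using assms(2) by (auto simp: as_def)
  qed
  have pv: "x + c *\<^sub>R \<omega> j \<in> paravectors" if "x \<in> paravectors" "j \<in> {1..?N}" for x c j
    using that assms(2) by (intro subspace_add subspace_scale subspace_paravectors)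
  have per: "Z (x + 2 *\<^sub>R \<omega> j) = Z x" if "x \<in> paravectors" "j \<in> {1..?N}" for x j
    unfolding Z_def
    using pv[of 0 _ 2] that assms(2) subspace_paravectors as
    by (intro zeta_difference_periodic[OF basis _ _ assms(5,6)]) (auto intro: subspace_scale)
  \<comment> \<open>One translation is left over: the factor \<open>I + E\<^sub>i\<close> turns the period \<open>2 * \<omega>\<^sub>i\<close> of \<open>Z\<close> into the period \<open>\<omega>\<^sub>i\<close>.\<close>
  have S: "S_fun ?N \<omega> w i x = Z x + Z (x + \<omega> i)" for x
    unfolding S_fun_def Z_def as_def
    by (simp only: comp_apply foldr_comp_id_minus_translate id_plus_translate_def translate_def)
  show ?thesis
  proof (intro ballI conjI)
    fix x assume "x \<in> paravectors - int_lattice ?N \<omega>"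
    then have x: "x \<in> paravectors" by simp
    show "S_fun ?N \<omega> w i (x + \<omega> i) = S_fun ?N \<omega> w i x"
      using per[OF x assms(7)] unfolding S scaleR_2 by (simp add: add_ac)
    show "S_fun ?N \<omega> w i (x + 2 *\<^sub>R \<omega> k) = S_fun ?N \<omega> w i x" if "k \<in> {1..?N} - {i}" for k
      using per[OF x, of k] per[OF pv[OF x assms(7), of 1], of k] that unfolding S by (simp add: add_ac)
  qed
qed

end
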